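(* Let $\{x^k\}$ be generated by (VFKM) with $S^k=Gx^k-\gamma_kGx^{k-1}$, $\gamma_k\in[0,1)$, and $\widetilde S^k$ the SAGA estimator with mini-batch size $b$ ($1\le b\le n$) and table entries $\widehat G_i^k$. Define $$\Delta_k:=\frac1{nb}\sum_{i=1}^n\|G_ix^k-\gamma_kG_ix^{k-1}-(1-\gamma_k)\widehat G_i^k\|^2,\qquad U_k:=\frac1n\sum_{i=1}^n\|G_ix^k-G_ix^{k-1}\|^2,$$ $$\Theta:=\frac{2(n-b)(2n+b)+b^2}{nb^2},\qquad\hat\Theta:=\frac{2(n-b)(2n+b)}{nb^2}.$$ Then, for all $k\ge1$, $$\mathbb{E}_k[\widetilde S^k-S^k]=0,\qquad\mathbb{E}_k[\|\widetilde S^k-S^k\|^2]\le\mathbb{E}_k[\Delta_k],$$ $$\frac{1}{(1-\gamma_k)^2}\mathbb{E}_k[\Delta_k]\le\Big(1-\frac b{2n}\Big)\frac{1}{(1-\gamma_{k-1})^2}\Delta_{k-1}+\frac{\Theta}{(1-\gamma_k)^2}U_k+\frac{\hat\Theta}{(1-\gamma_{k-1})^2}U_{k-1}.$$ Consequently, $\widetilde S^k$ is a variance-reduced unbiased estimator of $S^k$ with $\rho:=\frac b{2n}\in(0,1)$, $\Theta=\frac{2(n-b)(2n+b)+b^2}{nb^2}$, $\hat\Theta=\frac{2(n-b)(2n+b)}{nb^2}$, and $\Delta_k=\frac1{nb}\sum_{i=1}^n\|G_ix^k-\gamma_kG_ix^{k-1}-(1-\gamma_k)\widehat G_i^k\|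^2$.
   Context: Setting. $n,p\ge1$ are integers, $[n]=\{1,\dots,n\}$, $G_i:\mathbb{R}^p\to\mathbb{R}^p$ are single-valued mappings, $Gx:=\frac1n\sum_{i=1}^nG_ix$. Method (VFKM). Given $x^0\in\mathbb{R}^p$, set $x^{-1}:=x^0$. At each $k\ge0$ construct an estimator $\widetilde S^k$ of $S^k:=Gx^k-\gamma_kGx^{k-1}$ (with $\widetilde S^0:=S^0$), and update $x^{k+1}:=x^k+\theta_k(x^k-x^{k-1})-\eta_k\widetilde S^k$ with given deterministic parameters $\theta_k,\gamma_k,\eta_k$. SAGA estimator. Set $\widehat G_i^0:=G_ix^0$ for $i\in[n]$. For $k\ge1$, with fresh randomness, draw an i.i.d. (uniform, with replacement) mini-batch $\mathcal{B}_k\subseteq[n]$ of size $b$ and, independently of $\mathcal{B}_k$, a uniformly random $\hat{\mathcal{B}}_k\subseteq[n]$ of size $b$ without replacement. Set $\widehat G_i^k:=G_ix^{k-1}$ if $i\in\hat{\mathcal{B}}_k$ and $\widehat G_i^k:=\widehat G_i^{k-1}$ otherwise. With $G_{\mathcal{B}_k}x:=\frac1b\sum_{i\in\mathcal{B}_k}G_ix$ and $\widehat G_{\mathcal{B}_k}^k:=\frac1b\sum_{i\in\mathcal{B}_k}\widehat G_i^k$, $$\widetilde S^k:=\frac{1-\gamma_k}{n}\sum_{i=1}^n\widehat G_i^k+\big[G_{\mathcal{B}_k}x^k-\gamma_kG_{\mathcal{B}_k}x^{k-1}-(1-\gamma_k)\widehat G_{\mathcal{B}_k}^k\big].$$ $\mathcal{F}_k$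 is the $\sigma$-algebra generated by all randomness of the algorithm up to iteration $k$ before sampling $\mathcal{B}_k$ and $\hat{\mathcal{B}}_k$; $\mathbb{E}_k[\cdot]:=\mathbb{E}[\cdot\mid\mathcal{F}_k]$. Variance-reduced unbiased estimator: there exist $\rho\in(0,1)$, $\Theta>0$, $\hat\Theta\ge0$ and nonnegative random variables $\{\Delta_k\}$ such that for all $k\ge1$, almost surely, $\mathbb{E}_k[\widetilde S^k-S^k]=0$, $\mathbb{E}_k[\|\widetilde S^k-S^k\|^2]\le\mathbb{E}_k[\Delta_k]$, and $\frac{1}{(1-\gamma_k)^2}\mathbb{E}_k[\Delta_k]\le\frac{1-\rho}{(1-\gamma_{k-1})^2}\Delta_{k-1}+\frac{\Theta}{(1-\gamma_k)^2}U_k+\frac{\hat\Theta}{(1-\gamma_{k-1})^2}U_{k-1}$. *)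

theory Defs
  imports "HOL-Probability.Probability"
begin

text \<open>
  Iterates are processes \<open>x :: nat \<Rightarrow> 'w \<Rightarrow> real ^ 'p\<close> on a probability space. The previous iterate is
  written \<open>x (k - 1)\<close> throughout; since subtraction on \<^typ>\<open>nat\<close> truncates, \<open>x (0 - 1) = x 0\<close>, which is
  exactly the convention \<open>x\<^sup>-\<^sup>1 := x\<^sup>0\<close>. The index set \<open>[n]\<close> is \<open>{1..n}\<close>.
\<close>

definition G_mean :: "nat \<Rightarrow> (nat \<Rightarrow> real ^ 'p \<Rightarrow> real ^ 'p) \<Rightarrow> real ^ 'p \<Rightarrow> real ^ 'p" where
  "G_mean n G y = (1 / real n) *\<^sub>R (\<Sum>i=1..n. G i y)"

definition S_target ::
  "nat \<Rightarrow> (nat \<Rightarrow> real ^ 'p \<Rightarrow> real ^ 'p) \<Rightarrow> (nat \<Rightarrow> real) \<Rightarrow> (nat \<Rightarrow> 'w \<Rightarrow> real ^ 'p)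
   \<Rightarrow> nat \<Rightarrow> 'w \<Rightarrow> real ^ 'p" where
  "S_target n G \<gamma> x k \<omega> = G_mean n G (x k \<omega>) - \<gamma> k *\<^sub>R G_mean n G (x (k - 1) \<omega>)"

definition is_VFKM ::
  "'w measure \<Rightarrow> (nat \<Rightarrow> real) \<Rightarrow> (nat \<Rightarrow> real) \<Rightarrow> real ^ 'p \<Rightarrow> (nat \<Rightarrow> 'w \<Rightarrow> real ^ 'p)
   \<Rightarrow> (nat \<Rightarrow> 'w \<Rightarrow> real ^ 'p) \<Rightarrow> bool" where
  "is_VFKM M \<theta> \<eta> x0 St x \<longleftrightarrow>
     (\<forall>\<omega>\<in>space M. x 0 \<omega> = x0 \<and>
        (\<forall>k. x (Suc k) \<omega> = x k \<omega> + \<theta> k *\<^sub>R (x k \<omega> - x (k - 1) \<omega>) - \<eta> k *\<^sub>R St k \<omega>))"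

text \<open>
  Sampling: \<open>B k j \<omega>\<close> is the \<open>j\<close>-th draw (\<open>j < b\<close>) of the mini-batch of iteration \<open>k\<close>, taken with
  replacement, so that sums over the mini-batch count repeated indices with multiplicity;
  \<open>Bh k \<omega>\<close> is the size-\<open>b\<close> subset of \<open>[n]\<close> whose table entries are refreshed.
  \<open>sampling_sigma M b B Bh K\<close> is the sigma-algebra generated by the samples of the iterations in \<open>K\<close>.
\<close>

definition sampling_sigma ::
  "'w measure \<Rightarrow> nat \<Rightarrow> (nat \<Rightarrow> nat \<Rightarrow> 'w \<Rightarrow> nat) \<Rightarrow> (nat \<Rightarrow> 'w \<Rightarrow> nat set) \<Rightarrow> nat set \<Rightarrow> 'w measure" where
  "sampling_sigma M b B Bh K = sigma (space M)
     ({B k j -` A \<inter> space M | k j A. k \<in> K \<and> j < b} \<union> {Bh k -` A \<inter> space M | k A. k \<in> K})"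

text \<open>
  The initial point is deterministic and iteration \<open>0\<close> draws no samples, so the information available
  before sampling in iteration \<open>k\<close> is generated by the samples of iterations \<open>1, \<dots>, k - 1\<close>.
\<close>

definition history ::
  "'w measure \<Rightarrow> nat \<Rightarrow> (nat \<Rightarrow> nat \<Rightarrow> 'w \<Rightarrow> nat) \<Rightarrow> (nat \<Rightarrow> 'w \<Rightarrow> nat set) \<Rightarrow> nat \<Rightarrow> 'w measure" where
  "history M b B Bh k = sampling_sigma M b B Bh {1..<k}"

locale saga_sampling = prob_space M
  for M :: "'w measure" +
  fixes n b :: nat
    and B :: "nat \<Rightarrow> nat \<Rightarrow> 'w \<Rightarrow> nat"
    and Bh :: "nat \<Rightarrow> 'w \<Rightarrow> nat set"
  assumes B_measurable:
      "\<And>k j. 1 \<le> k \<Longrightarrow> j < b \<Longrightarrow> B k j \<in> M \<rightarrow>\<^sub>M count_space {1..n}"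
    and B_uniform:
      "\<And>k j. 1 \<le> k \<Longrightarrow> j < b \<Longrightarrow> distr M (count_space {1..n}) (B k j) = uniform_count_measure {1..n}"
    and B_indep:
      "\<And>k. 1 \<le> k \<Longrightarrow> indep_vars (\<lambda>_. count_space {1..n}) (B k) {..<b}"
    and Bh_measurable:
      "\<And>k. 1 \<le> k \<Longrightarrow> Bh k \<in> M \<rightarrow>\<^sub>M count_space {A. A \<subseteq> {1..n} \<and> card A = b}"
    and Bh_uniform:
      "\<And>k. 1 \<le> k \<Longrightarrow> distr M (count_space {A. A \<subseteq> {1..n} \<and> card A = b}) (Bh k)
                       = uniform_count_measure {A. A \<subseteq> {1..n} \<and> card A = b}"
    and B_Bh_indep:
      "\<And>k. 1 \<le> k \<Longrightarrow> indep_set (sigma_sets (space M) {B k j -` A \<inter> space M | j A. j < b})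
                              (sigma_sets (space M) {Bh k -` A \<inter> space M | A. True})"
    and fresh:
      "\<And>k. 1 \<le> k \<Longrightarrow> indep_set (sets (history M b B Bh k)) (sets (sampling_sigma M b B Bh {k}))"

primrec saga_table ::
  "(nat \<Rightarrow> real ^ 'p \<Rightarrow> real ^ 'p) \<Rightarrow> (nat \<Rightarrow> 'w \<Rightarrow> nat set) \<Rightarrow> (nat \<Rightarrow> 'w \<Rightarrow> real ^ 'p)
   \<Rightarrow> nat \<Rightarrow> nat \<Rightarrow> 'w \<Rightarrow> real ^ 'p" where
  "saga_table G Bh x 0 i \<omega> = G i (x 0 \<omega>)"
| "saga_table G Bh x (Suc k) i \<omega> =
     (if i \<in> Bh (Suc k) \<omega> then G i (x k \<omega>) else saga_table G Bh x k i \<omega>)"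

definition saga_estimator ::
  "nat \<Rightarrow> nat \<Rightarrow> (nat \<Rightarrow> real ^ 'p \<Rightarrow> real ^ 'p) \<Rightarrow> (nat \<Rightarrow> real) \<Rightarrow> (nat \<Rightarrow> nat \<Rightarrow> 'w \<Rightarrow> nat)
   \<Rightarrow> (nat \<Rightarrow> 'w \<Rightarrow> nat set) \<Rightarrow> (nat \<Rightarrow> 'w \<Rightarrow> real ^ 'p) \<Rightarrow> nat \<Rightarrow> 'w \<Rightarrow> real ^ 'p" where
  "saga_estimator n b G \<gamma> B Bh x k \<omega> =
     (if k = 0 then S_target n G \<gamma> x 0 \<omega>
      else ((1 - \<gamma> k) / real n) *\<^sub>R (\<Sum>i=1..n. saga_table G Bh x k i \<omega>)
           + ((1 / real b) *\<^sub>R (\<Sum>j<b. G (B k j \<omega>) (x k \<omega>))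
              - \<gamma> k *\<^sub>R ((1 / real b) *\<^sub>R (\<Sum>j<b. G (B k j \<omega>) (x (k - 1) \<omega>)))
              - (1 - \<gamma> k) *\<^sub>R ((1 / real b) *\<^sub>R (\<Sum>j<b. saga_table G Bh x k (B k j \<omega>) \<omega>))))"

definition saga_Delta ::
  "nat \<Rightarrow> nat \<Rightarrow> (nat \<Rightarrow> real ^ 'p \<Rightarrow> real ^ 'p) \<Rightarrow> (nat \<Rightarrow> real)
   \<Rightarrow> (nat \<Rightarrow> 'w \<Rightarrow> nat set) \<Rightarrow> (nat \<Rightarrow> 'w \<Rightarrow> real ^ 'p) \<Rightarrow> nat \<Rightarrow> 'w \<Rightarrow> real" where
  "saga_Delta n b G \<gamma> Bh x k \<omega> = 1 / (real n * real b) *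
     (\<Sum>i=1..n. (norm (G i (x k \<omega>) - \<gamma> k *\<^sub>R G i (x (k - 1) \<omega>)
                        - (1 - \<gamma> k) *\<^sub>R saga_table G Bh x k i \<omega>))\<^sup>2)"

definition G_increment ::
  "nat \<Rightarrow> (nat \<Rightarrow> real ^ 'p \<Rightarrow> real ^ 'p) \<Rightarrow> (nat \<Rightarrow> 'w \<Rightarrow> real ^ 'p) \<Rightarrow> nat \<Rightarrow> 'w \<Rightarrow> real" where
  "G_increment n G x k \<omega> =
     1 / real n * (\<Sum>i=1..n. (norm (G i (x k \<omega>) - G i (x (k - 1) \<omega>)))\<^sup>2)"

text \<open>
  The library provides conditional expectation for real-valued functions only;
  for vectors it is taken componentwise.
\<close>

definition vec_cond_exp ::
  "'w measure \<Rightarrow> 'w measure \<Rightarrow> ('w \<Rightarrow> real ^ 'p) \<Rightarrow> 'w \<Rightarrow> real ^ 'p" where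
  "vec_cond_exp M F f \<omega> = (\<chi> i. real_cond_exp M F (\<lambda>\<omega>'. f \<omega>' $ i) \<omega>)"

text \<open>
  Variance-reduced unbiased estimators, with the constants and the control process \<open>\<Delta>\<close> exposed as
  parameters. The integrability clauses make explicit that the conditional expectations exist, as
  \<^const>\<open>real_cond_exp\<close> is a total function with arbitrary values on non-integrable arguments.
\<close>

definition VR_unbiased_estimator ::
  "'w measure \<Rightarrow> (nat \<Rightarrow> 'w measure) \<Rightarrow> (nat \<Rightarrow> real) \<Rightarrow> (nat \<Rightarrow> 'w \<Rightarrow> real)
   \<Rightarrow> (nat \<Rightarrow> 'w \<Rightarrow> real ^ 'p) \<Rightarrow> (nat \<Rightarrow> 'w \<Rightarrow> real ^ 'p)
   \<Rightarrow> real \<Rightarrow> real \<Rightarrow> real \<Rightarrow> (nat \<Rightarrow> 'w \<Rightarrow> real) \<Rightarrow> bool" where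
  "VR_unbiased_estimator M F \<gamma> U S St \<rho> \<Theta> \<Theta>h \<Delta> \<longleftrightarrow>
     0 < \<rho> \<and> \<rho> < 1 \<and> 0 < \<Theta> \<and> 0 \<le> \<Theta>h \<and>
     (\<forall>k. \<Delta> k \<in> borel_measurable M \<and> (\<forall>\<omega>\<in>space M. 0 \<le> \<Delta> k \<omega>)) \<and>
     (\<forall>k\<ge>1.
        integrable M (\<lambda>\<omega>. St k \<omega> - S k \<omega>) \<and>
        integrable M (\<lambda>\<omega>. (norm (St k \<omega> - S k \<omega>))\<^sup>2) \<and>
        integrable M (\<Delta> k) \<and>
        (AE \<omega> in M. vec_cond_exp M (F k) (\<lambda>\<omega>'. St k \<omega>' - S k \<omega>') \<omega> = 0) \<and>
        (AE \<omega> in M. real_cond_exp M (F k) (\<lambda>\<omega>'. (norm (St k \<omega>' - S k \<omega>'))\<^sup>2) \<omega>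
                     \<le> real_cond_exp M (F k) (\<Delta> k) \<omega>) \<and>
        (AE \<omega> in M. 1 / (1 - \<gamma> k)\<^sup>2 * real_cond_exp M (F k) (\<Delta> k) \<omega>
                     \<le> (1 - \<rho>) / (1 - \<gamma> (k - 1))\<^sup>2 * \<Delta> (k - 1) \<omega>
                       + \<Theta> / (1 - \<gamma> k)\<^sup>2 * U k \<omega>
                       + \<Theta>h / (1 - \<gamma> (k - 1))\<^sup>2 * U (k - 1) \<omega>))"

end

theory Submission
  imports Defs
begin

text \<open>
  Given the past, iteration \<open>k\<close> is a function of two independent pieces of randomness: the state
  \<open>z = (x\<^sup>k, x\<^sup>k\<^sup>-\<^sup>1, table before the refresh)\<close>, which is known, and the fresh sample
  \<open>w = (refreshed subset, mini-batch)\<close>. All samples range over finite sets and the start is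
  deterministic, so every state has finitely many values. For a function \<open>f\<close> of \<open>z\<close> and \<open>w\<close> the
  conditional expectation therefore is the plain integral of \<open>f z\<close> over the sample, with \<open>z\<close> held
  fixed (\<open>real_cond_exp_history\<close>); it remains to compute three integrals for fixed \<open>z\<close>.

  Put \<open>r\<^sub>i = G\<^sub>i x\<^sup>k - \<gamma>\<^sub>k G\<^sub>i x\<^sup>k\<^sup>-\<^sup>1 - (1 - \<gamma>\<^sub>k) t\<^sub>i\<close>, where \<open>t\<close> is the refreshed table. The estimation
  error is the average of \<open>r\<close> over the mini-batch minus its average over \<open>{1..n}\<close>
  (\<open>saga_estimator_error\<close>). The refreshed subset, hence \<open>r\<close>, is independent of the mini-batch. So the
  error has mean zero, and since distinct draws are uncorrelated, its mean square is at most \<open>1 / (n b)\<close>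
  times the expected sum of the squares of \<open>r\<close>, which is the expectation of \<open>\<Delta>\<^sub>k\<close>.

  For the recursion, an index belongs to the refreshed subset with probability \<open>\<beta> = b / n\<close>. If it
  does, \<open>r\<^sub>i\<close> is the increment \<open>d\<^sub>i = G\<^sub>i x\<^sup>k - G\<^sub>i x\<^sup>k\<^sup>-\<^sup>1\<close>; otherwise \<open>r\<^sub>i = d\<^sub>i + (1 - \<gamma>\<^sub>k) v\<^sub>i\<close>, where
  \<open>v\<^sub>i = G\<^sub>i x\<^sup>k\<^sup>-\<^sup>1 - t\<^sub>i\<close> is the error of the unrefreshed entry. The residual of the previous iteration
  is \<open>(1 - \<gamma>\<^sub>k\<^sub>-\<^sub>1) v\<^sub>i\<close> up to a multiple of the previous increment. Young's inequality with parameter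
  \<open>\<beta> / 2\<close> bounds the second case, and the probability \<open>1 - \<beta>\<close> of that case turns the factor
  \<open>1 + \<beta> / 2\<close> in front of the old residual into a factor below \<open>1 - \<beta> / 2\<close> (\<open>refresh_contraction\<close>).
\<close>

section \<open>Conditioning functions of two independent simple random elements\<close>

lemma simple_function_subalgebra:
  assumes "subalgebra N F" "simple_function F f"
  shows "simple_function N f"
  using assms by (auto simp: subalgebra_def simple_function_def)

lemma simple_function_restrict_lessThan:
  fixes m :: nat
  assumes "\<And>j. j < m \<Longrightarrow> simple_function N (X j)"
  shows "simple_function N (\<lambda>\<omega>. \<lambda>j\<in>{..<m}. X j \<omega>)"
  using assms
proof (induction m)
  case 0
  then show ?case by (simp add: restrict_def)
next
  case (Suc m)
  have eq: "(\<lambda>j\<in>{..<Suc m}. X j \<omega>) = (\<lambda>j\<in>{..<m}. X j \<omega>)(m := X m \<omega>)" for \<omega>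
    by (auto simp: fun_eq_iff less_Suc_eq)
  have "simple_function N (\<lambda>\<omega>. \<lambda>j\<in>{..<m}. X j \<omega>)"
    by (rule Suc.IH) (simp add: Suc.prems)
  then show ?case
    unfolding eq
    by (rule simple_function_compose2[where h = "\<lambda>s y. s(m := y)"]) (rule Suc.prems, simp)
qed

context prob_space
begin

lemma indep_set_sym:
  assumes "indep_set \<A> \<B>"
  shows "indep_set \<B> \<A>"
  unfolding indep_sets2_eq
proof (intro conjI ballI)
  show "\<B> \<subseteq> events" "\<A> \<subseteq> events"
    by (fact indep_setD_ev2[OF assms] indep_setD_ev1[OF assms])+
  show "prob (a \<inter> b) = prob a * prob b" if "a \<in> \<B>" "b \<in> \<A>" for a b
    using indep_setD[OF assms that(2,1)] by (simp add: Int_commute mult.commute)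
qed

lemma integrable_simple:
  fixes f :: "'a \<Rightarrow> 'b::{banach,second_countable_topology}"
  assumes f: "simple_function M f"
  shows "integrable M f"
proof -
  have fin: "finite (norm ` f ` space M)"
    using simple_functionD(1)[OF f] by simp
  have "AE \<omega> in M. norm (f \<omega>) \<le> Max (norm ` f ` space M)"
    by (rule AE_I2) (use fin in auto)
  then show ?thesis
    by (rule integrable_const_bound) (rule borel_measurable_simple_function[OF f])
qed

text \<open>
  Fubini's theorem for an independent pair. As both random elements are simple, it reduces to
  \<open>prob (A \<inter> {Z = z} \<inter> {W = w}) = prob (A \<inter> {Z = z}) * prob {W = w}\<close>, summed over the values \<open>z\<close> and \<open>w\<close>.
\<close>

lemma indep_simple_integral:
  fixes f :: "'b \<Rightarrow> 'c \<Rightarrow> real"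
  assumes F: "subalgebra M F" and H: "subalgebra M H"
    and indep: "indep_set (sets F) (sets H)"
    and Z: "simple_function F Z" and W: "simple_function H W" and A: "A \<in> sets F"
  shows "(\<integral>\<omega>. indicator A \<omega> * f (Z \<omega>) (W \<omega>) \<partial>M)
       = (\<integral>\<omega>. indicator A \<omega> * (\<integral>\<omega>'. f (Z \<omega>) (W \<omega>') \<partial>M) \<partial>M)"
proof -
  have space: "space F = space M" "space H = space M"
    and FM: "sets F \<subseteq> events" and HM: "sets H \<subseteq> events"
    using F H by (auto simp: subalgebra_def)
  define Zs Ws where "Zs = Z ` space M" and "Ws = W ` space M"
  define ZE WE where "ZE z = Z -` {z} \<inter> space M" and "WE w = W -` {w} \<inter> space M" for z w
  have fin: "finite Zs" "finite Ws"
    using simple_functionD(1)[OF Z] simple_functionD(1)[OF W] by (auto simp: Zs_def Ws_def space)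
  have ZE: "ZE z \<in> sets F" and WE: "WE w \<in> sets H" for z w
    using simple_functionD(2)[OF Z] simple_functionD(2)[OF W] by (auto simp: ZE_def WE_def space)
  have ev: "A \<inter> ZE z \<in> events" "WE w \<in> events" "A \<inter> ZE z \<inter> WE w \<in> events" for z w
    using ZE WE A FM HM by (auto intro!: sets.Int)
  have ind: "integrable M (indicat_real E)" if "E \<in> events" for E
    using that by (simp add: integrable_indicator_iff less_top[symmetric])
  have inner: "(\<integral>\<omega>'. f z (W \<omega>') \<partial>M) = (\<Sum>w\<in>Ws. f z w * prob (WE w))" for z
  proof -
    have "(\<integral>\<omega>'. f z (W \<omega>') \<partial>M) = (\<integral>\<omega>'. (\<Sum>w\<in>Ws. f z w * indicator (WE w) \<omega>') \<partial>M)"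
      by (intro Bochner_Integration.integral_cong refl)
         (auto simp: WE_def Ws_def indicator_def fin[unfolded Ws_def] if_distrib sum.delta cong: if_cong)
    also have "\<dots> = (\<Sum>w\<in>Ws. f z w * prob (WE w))"
      using ev by (subst Bochner_Integration.integral_sum) (auto simp: ind)
    finally show ?thesis .
  qed
  have "(\<integral>\<omega>. indicator A \<omega> * f (Z \<omega>) (W \<omega>) \<partial>M)
      = (\<integral>\<omega>. (\<Sum>z\<in>Zs. \<Sum>w\<in>Ws. f z w * indicator (A \<inter> ZE z \<inter> WE w) \<omega>) \<partial>M)"
  proof (intro Bochner_Integration.integral_cong refl)
    fix \<omega> assume \<omega>: "\<omega> \<in> space M"
    have "(\<Sum>z\<in>Zs. \<Sum>w\<in>Ws. f z w * indicator (A \<inter> ZE z \<inter> WE w) \<omega>)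
        = (\<Sum>z\<in>Zs. \<Sum>w\<in>Ws. if w = W \<omega> then (if z = Z \<omega> then indicator A \<omega> * f z w else 0) else 0)"
      using \<omega> by (intro sum.cong refl) (auto simp: ZE_def WE_def indicator_def)
    also have "\<dots> = indicator A \<omega> * f (Z \<omega>) (W \<omega>)"
      using \<omega> fin by (simp add: sum.delta Zs_def Ws_def)
    finally show "indicator A \<omega> * f (Z \<omega>) (W \<omega>) = (\<Sum>z\<in>Zs. \<Sum>w\<in>Ws. f z w * indicator (A \<inter> ZE z \<inter> WE w) \<omega>)"
      by simp
  qed
  also have "\<dots> = (\<Sum>z\<in>Zs. \<Sum>w\<in>Ws. f z w * prob (A \<inter> ZE z \<inter> WE w))"
    using ev by (simp add: Bochner_Integration.integral_sum ind)
  also have "\<dots> = (\<Sum>z\<in>Zs. \<Sum>w\<in>Ws. f z w * (prob (A \<inter> ZE z) * prob (WE w)))"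
    using indep_setD[OF indep _ WE] A ZE by (simp add: sets.Int)
  also have "\<dots> = (\<Sum>z\<in>Zs. (\<integral>\<omega>'. f z (W \<omega>') \<partial>M) * prob (A \<inter> ZE z))"
    by (simp add: inner sum_distrib_left sum_distrib_right ac_simps)
  also have "\<dots> = (\<integral>\<omega>. (\<Sum>z\<in>Zs. (\<integral>\<omega>'. f z (W \<omega>') \<partial>M) * indicator (A \<inter> ZE z) \<omega>) \<partial>M)"
    using ev by (simp add: Bochner_Integration.integral_sum ind)
  also have "\<dots> = (\<integral>\<omega>. indicator A \<omega> * (\<integral>\<omega>'. f (Z \<omega>) (W \<omega>') \<partial>M) \<partial>M)"
  proof (intro Bochner_Integration.integral_cong refl)
    fix \<omega> assume \<omega>: "\<omega> \<in> space M"
    have "(\<Sum>z\<in>Zs. (\<integral>\<omega>'. f z (W \<omega>') \<partial>M) * indicator (A \<inter> ZE z) \<omega>)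
        = (\<Sum>z\<in>Zs. if z = Z \<omega> then indicator A \<omega> * (\<integral>\<omega>'. f z (W \<omega>') \<partial>M) else 0)"
      using \<omega> by (intro sum.cong refl) (auto simp: ZE_def indicator_def)
    then show "(\<Sum>z\<in>Zs. (\<integral>\<omega>'. f z (W \<omega>') \<partial>M) * indicator (A \<inter> ZE z) \<omega>)
        = indicator A \<omega> * (\<integral>\<omega>'. f (Z \<omega>) (W \<omega>') \<partial>M)"
      using \<omega> fin by (simp add: sum.delta Zs_def)
  qed
  finally show ?thesis .
qed

text \<open>
  The factor \<open>indicator A\<close> in \<open>indep_simple_integral\<close> is what the characterization of conditional expectation
  by its integrals over the events \<open>A\<close> of \<open>F\<close> asks for.
\<close>

lemma real_cond_exp_indep_simple:
  fixes f :: "'b \<Rightarrow> 'c \<Rightarrow> real"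
  assumes F: "subalgebra M F" and H: "subalgebra M H"
    and indep: "indep_set (sets F) (sets H)"
    and Z: "simple_function F Z" and W: "simple_function H W"
  shows "AE \<omega> in M. real_cond_exp M F (\<lambda>\<omega>. f (Z \<omega>) (W \<omega>)) \<omega> = (\<integral>\<omega>'. f (Z \<omega>) (W \<omega>') \<partial>M)"
proof -
  interpret finite_measure_subalgebra M F
    by standard (rule F)
  have g: "simple_function F (\<lambda>\<omega>. \<integral>\<omega>'. f (Z \<omega>) (W \<omega>') \<partial>M)"
    by (rule simple_function_compose1[OF Z])
  have "simple_function M Z" "simple_function M W"
    using Z W F H by (auto intro: simple_function_subalgebra)
  then have f: "simple_function M (\<lambda>\<omega>. f (Z \<omega>) (W \<omega>))"
    by (rule simple_function_compose2)
  show ?thesis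
  proof (rule real_cond_exp_charact)
    fix A assume "A \<in> sets F"
    from indep_simple_integral[OF F H indep Z W this]
    show "(\<integral>\<omega>\<in>A. f (Z \<omega>) (W \<omega>) \<partial>M) = (\<integral>\<omega>\<in>A. (\<integral>\<omega>'. f (Z \<omega>) (W \<omega>') \<partial>M) \<partial>M)"
      by (simp add: set_lebesgue_integral_def)
  next
    show "integrable M (\<lambda>\<omega>. f (Z \<omega>) (W \<omega>))"
      by (rule integrable_simple[OF f])
    show "integrable M (\<lambda>\<omega>. \<integral>\<omega>'. f (Z \<omega>) (W \<omega>') \<partial>M)"
      by (rule integrable_simple[OF simple_function_subalgebra[OF F g]])
    show "(\<lambda>\<omega>. \<integral>\<omega>'. f (Z \<omega>) (W \<omega>') \<partial>M) \<in> borel_measurable F"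
      by (rule borel_measurable_simple_function[OF g])
  qed
qed

end

section \<open>The information generated by the samples\<close>

context saga_sampling
begin

text \<open>
  The generators use preimages of arbitrary sets, whereas the samples are measurable into a finite
  target only; intersecting with that target does not change a preimage.
\<close>

lemma generators_in_events:
  assumes "K \<subseteq> {1..}"
  shows "{B k j -` A \<inter> space M | k j A. k \<in> K \<and> j < b} \<union> {Bh k -` A \<inter> space M | k A. k \<in> K} \<subseteq> events"
proof -
  have batch_event: "B k j -` A \<inter> space M \<in> events" if "k \<in> K" "j < b" for k j A
  proof -
    have m: "B k j \<in> M \<rightarrow>\<^sub>M count_space {1..n}"
      using that assms by (intro B_measurable) auto
    have "B k j -` A \<inter> space M = B k j -` (A \<inter> {1..n}) \<inter> space M"
      using measurable_space[OF m] by auto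
    also have "\<dots> \<in> events"
      by (rule measurable_sets[OF m]) simp
    finally show ?thesis .
  qed
  have subset_event: "Bh k -` A \<inter> space M \<in> events" if "k \<in> K" for k A
  proof -
    let ?S = "{A. A \<subseteq> {1..n} \<and> card A = b}"
    have m: "Bh k \<in> M \<rightarrow>\<^sub>M count_space ?S"
      using that assms by (intro Bh_measurable) auto
    have "Bh k -` A \<inter> space M = Bh k -` (A \<inter> ?S) \<inter> space M"
      using measurable_space[OF m] by auto
    also have "\<dots> \<in> events"
      by (rule measurable_sets[OF m]) simp
    finally show ?thesis .
  qed
  show ?thesis
    by (intro Un_least subsetI; elim CollectE exE conjE; hypsubst) (rule batch_event subset_event; assumption)+
qed

lemma space_sampling_sigma [simp]: "space (sampling_sigma M b B Bh K) = space M"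
  by (simp add: sampling_sigma_def space_measure_of_conv)

lemma sets_sampling_sigma:
  assumes "K \<subseteq> {1..}"
  shows "sets (sampling_sigma M b B Bh K) = sigma_sets (space M)
     ({B k j -` A \<inter> space M | k j A. k \<in> K \<and> j < b} \<union> {Bh k -` A \<inter> space M | k A. k \<in> K})"
  unfolding sampling_sigma_def
  by (rule sets_measure_of, rule order_trans[OF generators_in_events[OF assms] sets.space_closed])

lemma subalgebra_sampling_sigma:
  assumes "K \<subseteq> {1..}"
  shows "subalgebra M (sampling_sigma M b B Bh K)"
  unfolding subalgebra_def sets_sampling_sigma[OF assms] space_sampling_sigma
  by (rule conjI[OF refl sets.sigma_sets_subset[OF generators_in_events[OF assms]]])

lemma subalgebra_sampling_sigma_mono:
  assumes "K \<subseteq> L" "L \<subseteq> {1..}"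
  shows "subalgebra (sampling_sigma M b B Bh L) (sampling_sigma M b B Bh K)"
proof -
  have K: "K \<subseteq> {1..}" using assms by simp
  show ?thesis
    unfolding subalgebra_def sets_sampling_sigma[OF assms(2)] sets_sampling_sigma[OF K]
  proof
    show "sigma_sets (space M) ({B k j -` A \<inter> space M | k j A. k \<in> K \<and> j < b} \<union> {Bh k -` A \<inter> space M | k A. k \<in> K})
       \<subseteq> sigma_sets (space M) ({B k j -` A \<inter> space M | k j A. k \<in> L \<and> j < b} \<union> {Bh k -` A \<inter> space M | k A. k \<in> L})"
      by (intro sigma_sets_mono' Un_mono Collect_mono impI; elim exE conjE; intro exI conjI;
          (assumption | erule subsetD[OF assms(1)]))
  qed simp
qed

lemma finite_image_B: "1 \<le> k \<Longrightarrow> j < b \<Longrightarrow> finite (B k j ` space M)"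
  by (rule finite_subset[of _ "{1..n}"]) (use measurable_space[OF B_measurable] in auto)

lemma finite_image_Bh: "1 \<le> k \<Longrightarrow> finite (Bh k ` space M)"
  by (rule finite_subset[of _ "{A. A \<subseteq> {1..n} \<and> card A = b}"], rule image_subsetI)
     (simp_all add: measurable_space[OF Bh_measurable, simplified])

text \<open>
  The draws are cut off at \<open>b\<close> because nothing is known about \<open>B k j\<close> for \<open>j \<ge> b\<close>; only then does
  the sample have finitely many values.
\<close>

definition sample :: "nat \<Rightarrow> 'w \<Rightarrow> nat set \<times> (nat \<Rightarrow> nat)" where
  "sample k \<omega> = (Bh k \<omega>, \<lambda>j\<in>{..<b}. B k j \<omega>)"

lemma simple_sample:
  assumes "K \<subseteq> {1..}" "k \<in> K"
  shows "simple_function (sampling_sigma M b B Bh K) (sample k)"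
proof -
  have k: "1 \<le> k" using assms by auto
  have "Bh k -` A \<inter> space M \<in> sets (sampling_sigma M b B Bh K)" for A
    unfolding sets_sampling_sigma[OF assms(1)] by (rule sigma_sets.Basic) (use assms(2) in blast)
  then have "simple_function (sampling_sigma M b B Bh K) (Bh k)"
    unfolding simple_function_def using finite_image_Bh[OF k] by simp
  moreover have "simple_function (sampling_sigma M b B Bh K) (B k j)" if j: "j < b" for j
  proof -
    have "B k j -` A \<inter> space M \<in> sets (sampling_sigma M b B Bh K)" for A
      unfolding sets_sampling_sigma[OF assms(1)] by (rule sigma_sets.Basic) (use assms(2) j in blast)
    then show ?thesis
      unfolding simple_function_def using finite_image_B[OF k j] by simp
  qed
  ultimately show ?thesis
    unfolding sample_def[abs_def]
    by (intro simple_function_Pair simple_function_restrict_lessThan)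
qed

section \<open>Moments of the sample of one iteration\<close>

text \<open>
  The mini-batch can be averaged first, with the refreshed subset held fixed, because the two are
  independent.
\<close>

lemma expectation_sample:
  fixes f :: "nat set \<Rightarrow> (nat \<Rightarrow> nat) \<Rightarrow> real"
  assumes k: "1 \<le> k"
  shows "expectation (\<lambda>\<omega>. f (Bh k \<omega>) (\<lambda>j\<in>{..<b}. B k j \<omega>))
       = expectation (\<lambda>\<omega>. expectation (\<lambda>\<omega>'. f (Bh k \<omega>) (\<lambda>j\<in>{..<b}. B k j \<omega>')))"
proof -
  define EB EBh where "EB = {B k j -` A \<inter> space M | j A. j < b}" and "EBh = {Bh k -` A \<inter> space M | A. True}"
  define FB FBh where "FB = sigma (space M) EB" and "FBh = sigma (space M) EBh"
  have "EB \<subseteq> Pow (space M)" "EBh \<subseteq> Pow (space M)"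
    unfolding EB_def EBh_def by blast+
  then have sets_FB: "sets FB = sigma_sets (space M) EB" and sets_FBh: "sets FBh = sigma_sets (space M) EBh"
    unfolding FB_def FBh_def by (simp_all only: sets_measure_of)
  have spaces: "space FB = space M" "space FBh = space M"
    unfolding FB_def FBh_def by (rule space_measure_of_conv)+
  have ind: "indep_set (sets FBh) (sets FB)"
    unfolding sets_FB sets_FBh EB_def EBh_def by (rule indep_set_sym[OF B_Bh_indep[OF k]])
  have sub: "subalgebra M FBh" "subalgebra M FB"
    unfolding subalgebra_def spaces
    by (rule conjI[OF refl indep_setD_ev1[OF ind]], rule conjI[OF refl indep_setD_ev2[OF ind]])
  have "Bh k -` A \<inter> space M \<in> sets FBh" for A
    unfolding sets_FBh EBh_def by (rule sigma_sets.Basic) blast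
  then have Bh: "simple_function FBh (Bh k)"
    unfolding simple_function_def spaces using finite_image_Bh[OF k] by simp
  have B: "simple_function FB (\<lambda>\<omega>. \<lambda>j\<in>{..<b}. B k j \<omega>)"
  proof (rule simple_function_restrict_lessThan)
    fix j assume j: "j < b"
    have "B k j -` A \<inter> space M \<in> sets FB" for A
      unfolding sets_FB EB_def by (rule sigma_sets.Basic) (use j in blast)
    then show "simple_function FB (B k j)"
      unfolding simple_function_def spaces using finite_image_B[OF k j] by simp
  qed
  have "space M \<in> sets FBh" using sets.top[of FBh] unfolding spaces .
  note double = indep_simple_integral[OF sub ind Bh B this, of f]
  \<comment> \<open>The event in question is the whole space, so its indicator can be dropped.\<close>
  have ind1: "expectation (\<lambda>\<omega>. indicator (space M) \<omega> * h \<omega>) = expectation h" for h :: "'w \<Rightarrow> real"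
    by (intro Bochner_Integration.integral_cong) auto
  show ?thesis
    using double unfolding ind1 .
qed

lemma expectation_B:
  fixes f :: "nat \<Rightarrow> real"
  assumes "1 \<le> k" "j < b"
  shows "expectation (\<lambda>\<omega>. f (B k j \<omega>)) = (\<Sum>i=1..n. f i) / real n"
proof -
  have "expectation (\<lambda>\<omega>. f (B k j \<omega>)) = integral\<^sup>L (distr M (count_space {1..n}) (B k j)) f"
    using B_measurable[OF assms] by (simp add: integral_distr)
  also have "\<dots> = (\<Sum>i=1..n. f i) / real n"
    unfolding B_uniform[OF assms] integral_uniform_count_measure[OF finite_atLeastAtMost] by simp
  finally show ?thesis .
qed

text \<open>
  A uniformly chosen \<open>b\<close>-subset of an \<open>n\<close>-set contains a given element with probability \<open>b / n\<close>,
  because \<open>b * (n choose b) = n * ((n - 1) choose (b - 1))\<close>: the subsets that contain \<open>i\<close> arise by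
  adding \<open>i\<close> to a \<open>(b - 1)\<close>-subset of the rest.
\<close>

lemma expectation_refresh:
  fixes p q :: real
  assumes "1 \<le> k" "1 \<le> b" "b \<le> n" "i \<in> {1..n}"
  shows "expectation (\<lambda>\<omega>. if i \<in> Bh k \<omega> then p else q)
       = real b / real n * p + (1 - real b / real n) * q"
proof -
  let ?S = "{A. A \<subseteq> {1..n} \<and> card A = b}"
  have fin: "finite ?S" by simp
  have cS: "card ?S = n choose b" using n_subsets[of "{1..n}" b] by simp
  have "bij_betw (insert i) {A. A \<subseteq> {1..n} - {i} \<and> card A = b - 1} {A \<in> ?S. i \<in> A}"
  proof (rule bij_betw_byWitness[where f' = "\<lambda>A. A - {i}"])
    show "insert i ` {A. A \<subseteq> {1..n} - {i} \<and> card A = b - 1} \<subseteq> {A \<in> ?S. i \<in> A}"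
    proof (rule image_subsetI)
      fix A assume "A \<in> {A. A \<subseteq> {1..n} - {i} \<and> card A = b - 1}"
      then have A: "A \<subseteq> {1..n} - {i}" "card A = b - 1" by auto
      then have "finite A" "i \<notin> A" by (auto intro: finite_subset)
      with A assms show "insert i A \<in> {A \<in> ?S. i \<in> A}" by auto
    qed
    show "(\<lambda>A. A - {i}) ` {A \<in> ?S. i \<in> A} \<subseteq> {A. A \<subseteq> {1..n} - {i} \<and> card A = b - 1}"
      by auto
  qed auto
  from bij_betw_same_card[OF this]
  have ci: "card {A \<in> ?S. i \<in> A} = (n - 1) choose (b - 1)"
    using n_subsets[of "{1..n} - {i}" "b - 1"] assms by simp
  have "b * (n choose b) = n * ((n - 1) choose (b - 1))"
    using assms by (intro times_binomial_minus1_eq) simp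
  then have ratio: "real ((n - 1) choose (b - 1)) = real b / real n * real (n choose b)"
    using assms by (simp add: field_simps flip: of_nat_mult)
  have pos: "real (n choose b) > 0" using assms by simp
  have "expectation (\<lambda>\<omega>. if i \<in> Bh k \<omega> then p else q)
      = integral\<^sup>L (distr M (count_space ?S) (Bh k)) (\<lambda>A. if i \<in> A then p else q)"
    using Bh_measurable[OF assms(1)] by (subst integral_distr) auto
  also have "\<dots> = (\<Sum>A\<in>?S. if i \<in> A then p else q) / real (n choose b)"
    unfolding Bh_uniform[OF assms(1)] integral_uniform_count_measure[OF fin] cS ..
  also have "(\<Sum>A\<in>?S. if i \<in> A then p else q) = (\<Sum>A\<in>?S. q + (if i \<in> A then p - q else 0))"
    by (intro sum.cong) auto
  also have "\<dots> = real (card ?S) * q + real (card {A \<in> ?S. i \<in> A}) * (p - q)"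
    unfolding sum.distrib sum.inter_filter[OF fin, symmetric] by simp
  also have "\<dots> / real (n choose b) = real b / real n * p + (1 - real b / real n) * q"
  proof -
    have "(N * q + \<beta> * N * (p - q)) / N = \<beta> * p + (1 - \<beta>) * q" if "N > 0" for N \<beta> :: real
      using that by (simp add: field_simps)
    then show ?thesis using pos unfolding cS ci ratio by blast
  qed
  finally show ?thesis .
qed

end

definition batch_error :: "nat \<Rightarrow> nat \<Rightarrow> (nat \<Rightarrow> 'v::real_vector) \<Rightarrow> (nat \<Rightarrow> nat) \<Rightarrow> 'v" where
  "batch_error n b r s = (1 / real b) *\<^sub>R (\<Sum>j<b. r (s j)) - (1 / real n) *\<^sub>R (\<Sum>i=1..n. r i)"

lemma batch_error_component: "batch_error n b r s $ c = batch_error n b (\<lambda>i. r i $ c) s"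
  by (simp add: batch_error_def)

lemma batch_error_restrict [simp]: "batch_error n b r (restrict s {..<b}) = batch_error n b r s"
  by (simp add: batch_error_def)

context saga_sampling
begin

lemma integrable_of_B:
  fixes f :: "nat \<Rightarrow> real"
  assumes "1 \<le> k" "j < b"
  shows "integrable M (\<lambda>\<omega>. f (B k j \<omega>))"
proof -
  have "integrable (distr M (count_space {1..n}) (B k j)) f"
    unfolding B_uniform[OF assms] uniform_count_measure_def by (rule integrable_point_measure_finite) simp
  then show ?thesis using B_measurable[OF assms] by (simp add: integrable_distr_eq)
qed

lemma expectation_batch_error:
  fixes f :: "nat \<Rightarrow> real"
  assumes "1 \<le> k" "1 \<le> n" "1 \<le> b"
  shows "expectation (\<lambda>\<omega>. batch_error n b f (\<lambda>j. B k j \<omega>)) = 0"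
proof -
  have int: "integrable M (\<lambda>\<omega>. \<Sum>j<b. f (B k j \<omega>))"
    using integrable_of_B[OF assms(1), of _ f] by auto
  have "expectation (\<lambda>\<omega>. \<Sum>j<b. f (B k j \<omega>)) = real b * ((\<Sum>i=1..n. f i) / real n)"
    using integrable_of_B[OF assms(1), of _ f]
    by (subst Bochner_Integration.integral_sum) (auto simp: expectation_B[OF assms(1)])
  moreover have "expectation (\<lambda>\<omega>. batch_error n b f (\<lambda>j. B k j \<omega>))
      = expectation (\<lambda>\<omega>. \<Sum>j<b. f (B k j \<omega>)) / real b - (\<Sum>i=1..n. f i) / real n"
    using int by (simp add: batch_error_def prob_space)
  ultimately show ?thesis using assms by simp
qed

text \<open>
  The error of a sample mean. After centring, the mixed terms of the square vanish by independence, so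
  only \<open>b\<close> of the \<open>b\<^sup>2\<close> products contribute. Each contributes the population variance, which is at most
  the uncentred second moment.
\<close>

lemma expectation_batch_error_sq:
  fixes f :: "nat \<Rightarrow> real"
  assumes k: "1 \<le> k" and n: "1 \<le> n" and b: "1 \<le> b"
  shows "expectation (\<lambda>\<omega>. (batch_error n b f (\<lambda>j. B k j \<omega>))\<^sup>2) \<le> (\<Sum>i=1..n. (f i)\<^sup>2) / (real n * real b)"
proof -
  define m where "m = (\<Sum>i=1..n. f i) / real n"
  define g where "g i = f i - m" for i
  have g0: "(\<Sum>i=1..n. g i) = 0"
    using n by (simp add: g_def m_def sum_subtractf)
  have err: "batch_error n b f s = (\<Sum>j<b. g (s j)) / real b" for s
    using b by (simp add: batch_error_def g_def m_def sum_subtractf field_simps)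
  have cross: "expectation (\<lambda>\<omega>. g (B k j \<omega>) * g (B k l \<omega>)) = (if j = l then (\<Sum>i=1..n. (g i)\<^sup>2) / real n else 0)"
    and int: "integrable M (\<lambda>\<omega>. g (B k j \<omega>) * g (B k l \<omega>))"
    if "j < b" "l < b" for j l
  proof -
    have "integrable M (\<lambda>\<omega>. g (B k j \<omega>) * g (B k l \<omega>)) \<and>
      expectation (\<lambda>\<omega>. g (B k j \<omega>) * g (B k l \<omega>)) = (if j = l then (\<Sum>i=1..n. (g i)\<^sup>2) / real n else 0)"
    proof (cases "j = l")
      case True
      then show ?thesis
        using integrable_of_B[OF k that(1), of "\<lambda>i. g i * g i"] expectation_B[OF k that(1), of "\<lambda>i. g i * g i"]
        by (simp add: power2_eq_square)
    next
      case False
      have "indep_vars (\<lambda>_. borel) (\<lambda>j \<omega>. g (B k j \<omega>)) {..<b}"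
        by (rule indep_vars_compose2[OF B_indep[OF k]]) auto
      then have "indep_vars (\<lambda>_. borel) (\<lambda>j \<omega>. g (B k j \<omega>)) {j, l}"
        by (rule indep_vars_subset) (use that in auto)
      then have "integrable M (\<lambda>\<omega>. \<Prod>i\<in>{j, l}. g (B k i \<omega>)) \<and>
         expectation (\<lambda>\<omega>. \<Prod>i\<in>{j, l}. g (B k i \<omega>)) = (\<Prod>i\<in>{j, l}. expectation (\<lambda>\<omega>. g (B k i \<omega>)))"
        using that integrable_of_B[OF k, of _ g]
        by (intro conjI indep_vars_integrable indep_vars_lebesgue_integral) auto
      then show ?thesis
        using False that by (simp add: expectation_B[OF k] g0[simplified])
    qed
    then show "expectation (\<lambda>\<omega>. g (B k j \<omega>) * g (B k l \<omega>)) = (if j = l then (\<Sum>i=1..n. (g i)\<^sup>2) / real n else 0)"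
      "integrable M (\<lambda>\<omega>. g (B k j \<omega>) * g (B k l \<omega>))" by blast+
  qed
  have "expectation (\<lambda>\<omega>. (batch_error n b f (\<lambda>j. B k j \<omega>))\<^sup>2)
      = expectation (\<lambda>\<omega>. \<Sum>j<b. \<Sum>l<b. g (B k j \<omega>) * g (B k l \<omega>)) / (real b)\<^sup>2"
    by (simp add: err power_divide) (simp add: power2_eq_square sum_product)
  also have "expectation (\<lambda>\<omega>. \<Sum>j<b. \<Sum>l<b. g (B k j \<omega>) * g (B k l \<omega>))
      = (\<Sum>j<b. \<Sum>l<b. if j = l then (\<Sum>i=1..n. (g i)\<^sup>2) / real n else 0)"
  proof -
    have "expectation (\<lambda>\<omega>. \<Sum>j<b. \<Sum>l<b. g (B k j \<omega>) * g (B k l \<omega>))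
        = (\<Sum>j<b. expectation (\<lambda>\<omega>. \<Sum>l<b. g (B k j \<omega>) * g (B k l \<omega>)))"
      by (rule Bochner_Integration.integral_sum) (auto intro!: Bochner_Integration.integrable_sum int)
    also have "\<dots> = (\<Sum>j<b. \<Sum>l<b. expectation (\<lambda>\<omega>. g (B k j \<omega>) * g (B k l \<omega>)))"
      by (intro sum.cong refl Bochner_Integration.integral_sum) (auto intro!: int)
    finally show ?thesis by (simp add: cross)
  qed
  also have "\<dots> = real b * ((\<Sum>i=1..n. (g i)\<^sup>2) / real n)"
    by simp
  also have "\<dots> / (real b)\<^sup>2 = (\<Sum>i=1..n. (g i)\<^sup>2) / (real n * real b)"
    using b by (simp add: power2_eq_square)
  also have "(\<Sum>i=1..n. (g i)\<^sup>2) \<le> (\<Sum>i=1..n. (f i)\<^sup>2)"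
  proof -
    have "(\<Sum>i=1..n. (f i)\<^sup>2) = (\<Sum>i=1..n. (g i)\<^sup>2 + 2 * m * g i + m\<^sup>2)"
      by (intro sum.cong refl) (simp add: g_def power2_eq_square algebra_simps)
    also have "\<dots> = (\<Sum>i=1..n. (g i)\<^sup>2) + 2 * m * (\<Sum>i=1..n. g i) + real n * m\<^sup>2"
      by (simp add: sum.distrib sum_distrib_left)
    finally show ?thesis using g0 by simp
  qed
  finally show ?thesis using n b by (simp add: divide_right_mono)
qed

end

section \<open>The contraction achieved by a partial refresh\<close>

text \<open>
  Young's inequality: with \<open>norm p + norm q\<close> in place of \<open>norm (p + q)\<close>, the two sides differ by
  \<open>(c * norm p - norm q)\<^sup>2 / c\<close>.
\<close>

lemma norm_add_sq_le:
  fixes p q :: "'v::real_normed_vector"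
  assumes c: "0 < c"
  shows "(norm (p + q))\<^sup>2 \<le> (1 + c) * (norm p)\<^sup>2 + (1 + 1 / c) * (norm q)\<^sup>2"
proof -
  have "(norm (p + q))\<^sup>2 \<le> (norm p + norm q)\<^sup>2"
    by (intro power_mono norm_triangle_ineq) simp
  also have "\<dots> = (1 + c) * (norm p)\<^sup>2 + (1 + 1 / c) * (norm q)\<^sup>2 - (c * norm p - norm q)\<^sup>2 / c"
    using c by (simp add: power2_sum power2_diff power_mult_distrib diff_divide_distrib add_divide_distrib
        ring_distribs) (simp add: power2_eq_square)
  also have "\<dots> \<le> (1 + c) * (norm p)\<^sup>2 + (1 + 1 / c) * (norm q)\<^sup>2"
    using c by simp
  finally show ?thesis .
qed

text \<open>
  One table entry: \<open>d\<close> and \<open>d'\<close> are the current and the previous increment, \<open>v\<close> is the error of the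
  unrefreshed entry and \<open>a'\<close> the residual of the previous iteration. Writing
  \<open>d / (1 - \<gamma>) + v = p + (q + q')\<close>, with \<open>p\<close>, \<open>q\<close>, \<open>q'\<close> the rescaled multiples of \<open>a'\<close>, \<open>d\<close>, \<open>d'\<close>, Young's
  inequality with parameter \<open>\<beta> / 2\<close> isolates \<open>p\<close>, and with parameter \<open>1\<close> it separates \<open>q\<close> from \<open>q'\<close>.
  The choice \<open>\<beta> / 2\<close> ensures \<open>(1 - \<beta>) (1 + \<beta> / 2) \<le> 1 - \<beta> / 2\<close>; unlike the largest parameter with
  this effect, \<open>\<beta> / (2 (1 - \<beta>))\<close>, it also makes sense when the whole table is refreshed, \<open>\<beta> = 1\<close>.
\<close>

lemma refresh_contraction:
  fixes a' d d' v :: "'v::real_normed_vector"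
  assumes \<beta>: "0 < \<beta>" "\<beta> \<le> 1" and \<gamma>: "\<gamma> < 1" and \<gamma>': "0 \<le> \<gamma>'" "\<gamma>' < 1"
    and v: "a' = (1 - \<gamma>') *\<^sub>R v + \<gamma>' *\<^sub>R d'"
  defines "C \<equiv> 2 * (1 - \<beta>) * (1 + 2 / \<beta>)"
  shows "1 / (1 - \<gamma>)\<^sup>2 * (\<beta> * (norm d)\<^sup>2 + (1 - \<beta>) * (norm (d + (1 - \<gamma>) *\<^sub>R v))\<^sup>2)
    \<le> (1 - \<beta> / 2) / (1 - \<gamma>')\<^sup>2 * (norm a')\<^sup>2 + (\<beta> + C) / (1 - \<gamma>)\<^sup>2 * (norm d)\<^sup>2
       + C / (1 - \<gamma>')\<^sup>2 * (norm d')\<^sup>2"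
proof -
  define \<alpha> \<alpha>' where "\<alpha> = 1 - \<gamma>" and "\<alpha>' = 1 - \<gamma>'"
  have \<alpha>: "\<alpha> > 0" "\<alpha>' > 0" using \<gamma> \<gamma>' by (auto simp: \<alpha>_def \<alpha>'_def)
  define p q q' where "p = (1 / \<alpha>') *\<^sub>R a'" and "q = (1 / \<alpha>) *\<^sub>R d" and "q' = - (\<gamma>' / \<alpha>') *\<^sub>R d'"
  have sq: "(norm p)\<^sup>2 = (norm a')\<^sup>2 / \<alpha>'\<^sup>2" "(norm q)\<^sup>2 = (norm d)\<^sup>2 / \<alpha>\<^sup>2"
    using \<alpha> by (auto simp: p_def q_def power_divide)
  have sq': "(norm q')\<^sup>2 \<le> (norm d')\<^sup>2 / \<alpha>'\<^sup>2"
  proof -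
    have "(norm q')\<^sup>2 = \<gamma>'\<^sup>2 * ((norm d')\<^sup>2 / \<alpha>'\<^sup>2)"
      by (simp add: q'_def power_mult_distrib power_divide)
    also have "\<dots> \<le> 1 * ((norm d')\<^sup>2 / \<alpha>'\<^sup>2)"
      using \<gamma>' by (intro mult_right_mono) (auto simp: power_le_one)
    finally show ?thesis by simp
  qed
  have "\<alpha>' *\<^sub>R v = a' - \<gamma>' *\<^sub>R d'" using v by (simp add: \<alpha>'_def)
  then have "(1 / \<alpha>') *\<^sub>R (\<alpha>' *\<^sub>R v) = (1 / \<alpha>') *\<^sub>R (a' - \<gamma>' *\<^sub>R d')" by simp
  then have "v = p + q'"
    using \<alpha> by (simp add: p_def q'_def scaleR_diff_right)
  then have "d + \<alpha> *\<^sub>R v = \<alpha> *\<^sub>R (p + (q + q'))"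
    using \<alpha> by (simp add: q_def scaleR_add_right)
  then have "(norm (d + \<alpha> *\<^sub>R v))\<^sup>2 / \<alpha>\<^sup>2 = (norm (p + (q + q')))\<^sup>2"
    using \<alpha> by (simp add: power_mult_distrib)
  also have "\<dots> \<le> (1 + \<beta> / 2) * (norm p)\<^sup>2 + (1 + 2 / \<beta>) * (norm (q + q'))\<^sup>2"
    using norm_add_sq_le[of "\<beta> / 2" p "q + q'"] \<beta> by simp
  also have "\<dots> \<le> (1 + \<beta> / 2) * (norm p)\<^sup>2 + (1 + 2 / \<beta>) * (2 * (norm q)\<^sup>2 + 2 * (norm q')\<^sup>2)"
    using norm_add_sq_le[of 1 q q'] \<beta> by (intro add_left_mono mult_left_mono) auto
  also have "\<dots> \<le> (1 + \<beta> / 2) * (norm p)\<^sup>2 + (1 + 2 / \<beta>) * (2 * (norm q)\<^sup>2 + 2 * ((norm d')\<^sup>2 / \<alpha>'\<^sup>2))"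
    using sq' \<beta> by (intro add_left_mono mult_left_mono) auto
  finally have "(1 - \<beta>) * ((norm (d + \<alpha> *\<^sub>R v))\<^sup>2 / \<alpha>\<^sup>2)
      \<le> (1 - \<beta>) * ((1 + \<beta> / 2) * (norm p)\<^sup>2 + (1 + 2 / \<beta>) * (2 * (norm q)\<^sup>2 + 2 * ((norm d')\<^sup>2 / \<alpha>'\<^sup>2)))"
    using \<beta> by (intro mult_left_mono) auto
  also have "\<dots> = (1 - \<beta>) * (1 + \<beta> / 2) * (norm p)\<^sup>2 + C * (norm q)\<^sup>2 + C * ((norm d')\<^sup>2 / \<alpha>'\<^sup>2)"
  proof -
    have "(1 - \<beta>) * (r * P + t * (2 * Q + 2 * R)) = (1 - \<beta>) * r * P + 2 * (1 - \<beta>) * t * Q + 2 * (1 - \<beta>) * t * R"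
      for r t P Q R :: real
      by (simp add: algebra_simps)
    then show ?thesis unfolding C_def .
  qed
  also have "(1 - \<beta>) * (1 + \<beta> / 2) * (norm p)\<^sup>2 \<le> (1 - \<beta> / 2) * (norm p)\<^sup>2"
    by (intro mult_right_mono) (auto simp: algebra_simps)
  finally have main: "(1 - \<beta>) * ((norm (d + \<alpha> *\<^sub>R v))\<^sup>2 / \<alpha>\<^sup>2)
      \<le> (1 - \<beta> / 2) * (norm p)\<^sup>2 + C * (norm q)\<^sup>2 + C * ((norm d')\<^sup>2 / \<alpha>'\<^sup>2)"
    by simp
  have "1 / \<alpha>\<^sup>2 * (\<beta> * (norm d)\<^sup>2 + (1 - \<beta>) * (norm (d + \<alpha> *\<^sub>R v))\<^sup>2)
      = \<beta> * (norm q)\<^sup>2 + (1 - \<beta>) * ((norm (d + \<alpha> *\<^sub>R v))\<^sup>2 / \<alpha>\<^sup>2)"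
    unfolding sq by (simp add: add_divide_distrib)
  also have "\<dots> \<le> (1 - \<beta> / 2) * (norm p)\<^sup>2 + (\<beta> + C) * (norm q)\<^sup>2 + C * ((norm d')\<^sup>2 / \<alpha>'\<^sup>2)"
    using main by (simp add: distrib_right)
  finally show ?thesis
    unfolding sq \<alpha>_def[symmetric] \<alpha>'_def[symmetric] by simp
qed

section \<open>One iteration as a function of state and sample\<close>

definition refresh :: "nat set \<Rightarrow> (nat \<Rightarrow> 'v) \<Rightarrow> (nat \<Rightarrow> 'v) \<Rightarrow> nat \<Rightarrow> 'v" where
  "refresh A u t i = (if i \<in> A then u i else t i)"

text \<open>
  The table is taken before the refresh of iteration \<open>k\<close>, so that the state is determined by the
  samples of the iterations before \<open>k\<close>.
\<close>

definition saga_state ::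
  "(nat \<Rightarrow> real ^ 'p \<Rightarrow> real ^ 'p) \<Rightarrow> (nat \<Rightarrow> 'w \<Rightarrow> nat set) \<Rightarrow> (nat \<Rightarrow> 'w \<Rightarrow> real ^ 'p)
   \<Rightarrow> nat \<Rightarrow> 'w \<Rightarrow> (real ^ 'p) \<times> (real ^ 'p) \<times> (nat \<Rightarrow> real ^ 'p)" where
  "saga_state G Bh x k \<omega> = (x k \<omega>, x (k - 1) \<omega>, \<lambda>i. saga_table G Bh x (k - 1) i \<omega>)"

text \<open>
  The vector that \<open>\<Delta>\<^sub>k\<close> and the estimation error are built from, as a function of the state and of the
  refreshed subset \<open>A\<close>. It is kept as a function of \<open>A\<close> so that \<open>A\<close> can be integrated out while the
  state is fixed.
\<close>

definition refreshed_residual ::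
  "(nat \<Rightarrow> 'v \<Rightarrow> 'v) \<Rightarrow> real \<Rightarrow> 'v \<times> 'v \<times> (nat \<Rightarrow> 'v) \<Rightarrow> nat set \<Rightarrow> nat \<Rightarrow> 'v::real_vector" where
  "refreshed_residual G c z A i = (case z of (y, y', t) \<Rightarrow>
     G i y - c *\<^sub>R G i y' - (1 - c) *\<^sub>R refresh A (\<lambda>i. G i y') t i)"

lemma refreshed_residual_state:
  assumes "1 \<le> k"
  shows "refreshed_residual G c (saga_state G Bh x k \<omega>) (Bh k \<omega>) i
       = G i (x k \<omega>) - c *\<^sub>R G i (x (k - 1) \<omega>) - (1 - c) *\<^sub>R saga_table G Bh x k i \<omega>"
  using assms by (cases k) (auto simp: refreshed_residual_def saga_state_def refresh_def)

lemma saga_estimator_error: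
  assumes "1 \<le> k"
  shows "saga_estimator n b G \<gamma> B Bh x k \<omega> - S_target n G \<gamma> x k \<omega>
       = batch_error n b (refreshed_residual G (\<gamma> k) (saga_state G Bh x k \<omega>) (Bh k \<omega>)) (\<lambda>j. B k j \<omega>)"
  using assms
  by (simp add: saga_estimator_def S_target_def G_mean_def batch_error_def refreshed_residual_state
      sum_subtractf scaleR_sum_right[symmetric] scaleR_diff_right scaleR_left_commute mult.commute)

lemma saga_Delta_state:
  assumes "1 \<le> k"
  shows "saga_Delta n b G \<gamma> Bh x k \<omega> = 1 / (real n * real b) *
     (\<Sum>i=1..n. (norm (refreshed_residual G (\<gamma> k) (saga_state G Bh x k \<omega>) (Bh k \<omega>) i))\<^sup>2)"
  using assms by (simp add: saga_Delta_def refreshed_residual_state)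

context saga_sampling
begin

text \<open>
  Each state is a fixed function of the previous state and sample, and the first one is constant. Simplicity
  is preserved by arbitrary functions, hence by these.
\<close>

lemma simple_saga_state:
  fixes x :: "nat \<Rightarrow> 'w \<Rightarrow> real ^ 'p"
  assumes vfkm: "is_VFKM M \<theta> \<eta> x0 (saga_estimator n b G \<gamma> B Bh x) x" and k: "1 \<le> k"
  shows "simple_function (history M b B Bh k) (saga_state G Bh x k)"
  using k
proof (induction k rule: nat_induct_at_least)
  case base
  let ?c = "(x0 - \<eta> 0 *\<^sub>R (G_mean n G x0 - \<gamma> 0 *\<^sub>R G_mean n G x0), x0, \<lambda>i. G i x0)"
  have "saga_state G Bh x 1 \<omega> = ?c" if "\<omega> \<in> space M" for \<omega>
  proof -
    have x0: "x 0 \<omega> = x0" and x1: "x (Suc 0) \<omega> = x 0 \<omega> + \<theta> 0 *\<^sub>R (x 0 \<omega> - x (0 - 1) \<omega>)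
        - \<eta> 0 *\<^sub>R saga_estimator n b G \<gamma> B Bh x 0 \<omega>"
      using vfkm that unfolding is_VFKM_def by blast+
    show ?thesis
      by (simp add: saga_state_def x1 x0 saga_estimator_def S_target_def)
  qed
  then have "simple_function (history M b B Bh 1) (saga_state G Bh x 1)
         = simple_function (history M b B Bh 1) (\<lambda>_. ?c)"
    by (intro simple_function_cong) (simp add: history_def)
  then show ?case by simp
next
  case (Suc k)
  define err where "err z w = batch_error n b (refreshed_residual G (\<gamma> k) z (fst w)) (snd w)"
    for z :: "(real ^ 'p) \<times> (real ^ 'p) \<times> (nat \<Rightarrow> real ^ 'p)" and w :: "nat set \<times> (nat \<Rightarrow> nat)"
  define step where "step z w = (case z of (y, y', t) \<Rightarrow>
      (y + \<theta> k *\<^sub>R (y - y') - \<eta> k *\<^sub>R (G_mean n G y - \<gamma> k *\<^sub>R G_mean n G y' + err z w),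
       y, refresh (fst w) (\<lambda>i. G i y') t))" for z w
  have "saga_state G Bh x (Suc k) \<omega> = step (saga_state G Bh x k \<omega>) (sample k \<omega>)" if "\<omega> \<in> space M" for \<omega>
  proof -
    have "saga_estimator n b G \<gamma> B Bh x k \<omega> = S_target n G \<gamma> x k \<omega> + err (saga_state G Bh x k \<omega>) (sample k \<omega>)"
      using saga_estimator_error[OF Suc(1), of n b G \<gamma> B Bh x \<omega>]
      by (simp add: err_def sample_def algebra_simps)
    moreover have "x (Suc k) \<omega> = x k \<omega> + \<theta> k *\<^sub>R (x k \<omega> - x (k - 1) \<omega>)
        - \<eta> k *\<^sub>R saga_estimator n b G \<gamma> B Bh x k \<omega>"
      using vfkm that unfolding is_VFKM_def by blast
    moreover have "(\<lambda>i. saga_table G Bh x k i \<omega>)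
        = refresh (Bh k \<omega>) (\<lambda>i. G i (x (k - 1) \<omega>)) (\<lambda>i. saga_table G Bh x (k - 1) i \<omega>)"
      using Suc(1) by (cases k) (auto simp: refresh_def fun_eq_iff)
    ultimately show ?thesis
      by (simp add: step_def saga_state_def sample_def S_target_def)
  qed
  then have "simple_function (history M b B Bh (Suc k)) (saga_state G Bh x (Suc k))
         = simple_function (history M b B Bh (Suc k)) (\<lambda>\<omega>. step (saga_state G Bh x k \<omega>) (sample k \<omega>))"
    by (intro simple_function_cong) (simp add: history_def)
  moreover have "simple_function (history M b B Bh (Suc k)) (saga_state G Bh x k)"
    using Suc(2) unfolding history_def
    by (rule simple_function_subalgebra[rotated]) (rule subalgebra_sampling_sigma_mono; auto)
  moreover have "simple_function (history M b B Bh (Suc k)) (sample k)"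
    unfolding history_def by (rule simple_sample) (use Suc(1) in auto)
  ultimately show ?case
    by (simp add: simple_function_compose2)
qed

lemma subalgebra_history: "subalgebra M (history M b B Bh k)"
  unfolding history_def by (rule subalgebra_sampling_sigma) auto

lemma simple_sample_M: "1 \<le> k \<Longrightarrow> simple_function M (sample k)"
  by (rule simple_function_subalgebra[OF subalgebra_sampling_sigma simple_sample, of "{k}"]) auto

lemma integrable_of_sample:
  fixes f :: "nat set \<Rightarrow> (nat \<Rightarrow> nat) \<Rightarrow> real"
  assumes "1 \<le> k"
  shows "integrable M (\<lambda>\<omega>. f (Bh k \<omega>) (\<lambda>j\<in>{..<b}. B k j \<omega>))"
  using integrable_simple[OF simple_function_compose1[OF simple_sample_M[OF assms], of "case_prod f"]]
  by (simp add: sample_def)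

lemma integrable_of_state_sample:
  fixes f :: "(real ^ 'p) \<times> (real ^ 'p) \<times> (nat \<Rightarrow> real ^ 'p) \<Rightarrow> nat set \<times> (nat \<Rightarrow> nat)
    \<Rightarrow> 'v::{banach,second_countable_topology}"
  assumes "is_VFKM M \<theta> \<eta> x0 (saga_estimator n b G \<gamma> B Bh x) x" and k: "1 \<le> k"
  shows "integrable M (\<lambda>\<omega>. f (saga_state G Bh x k \<omega>) (sample k \<omega>))"
proof -
  have "simple_function M (saga_state G Bh x k)"
    by (rule simple_function_subalgebra[OF subalgebra_history simple_saga_state[OF assms]])
  from simple_function_compose2[OF this simple_sample_M[OF k]] show ?thesis
    by (rule integrable_simple)
qed

text \<open>
  This turns every conditional expectation into an integral over the fresh sample for a fixed state.
\<close>

lemma real_cond_exp_history: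
  fixes f :: "(real ^ 'p) \<times> (real ^ 'p) \<times> (nat \<Rightarrow> real ^ 'p) \<Rightarrow> nat set \<times> (nat \<Rightarrow> nat) \<Rightarrow> real"
  assumes "is_VFKM M \<theta> \<eta> x0 (saga_estimator n b G \<gamma> B Bh x) x" and k: "1 \<le> k"
  shows "AE \<omega> in M. real_cond_exp M (history M b B Bh k) (\<lambda>\<omega>. f (saga_state G Bh x k \<omega>) (sample k \<omega>)) \<omega>
       = expectation (\<lambda>\<omega>'. f (saga_state G Bh x k \<omega>) (sample k \<omega>'))"
proof (rule real_cond_exp_indep_simple[OF subalgebra_history _ fresh[OF k]])
  show "subalgebra M (sampling_sigma M b B Bh {k})" "simple_function (sampling_sigma M b B Bh {k}) (sample k)"
    using k by (auto intro: subalgebra_sampling_sigma simple_sample)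
qed (rule simple_saga_state[OF assms])

section \<open>The three moment estimates for a fixed state\<close>

lemma expectation_estimator_error:
  fixes G :: "nat \<Rightarrow> real ^ 'p \<Rightarrow> real ^ 'p"
  assumes k: "1 \<le> k" and n: "1 \<le> n" and b: "1 \<le> b"
  shows "expectation (\<lambda>\<omega>. batch_error n b (refreshed_residual G c z (fst (sample k \<omega>))) (snd (sample k \<omega>)) $ i) = 0"
  unfolding sample_def fst_conv snd_conv
  by (subst expectation_sample[OF k]) (simp add: batch_error_component expectation_batch_error[OF k n b])

text \<open>
  For a fixed refreshed subset the bound is that of a sample mean, applied to each coordinate and
  summed; averaging it over the subset gives the claim.
\<close>

lemma expectation_estimator_error_sq:
  fixes G :: "nat \<Rightarrow> real ^ 'p \<Rightarrow> real ^ 'p"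
  assumes k: "1 \<le> k" and n: "1 \<le> n" and b: "1 \<le> b"
  shows "expectation (\<lambda>\<omega>. (norm (batch_error n b (refreshed_residual G c z (fst (sample k \<omega>))) (snd (sample k \<omega>))))\<^sup>2)
    \<le> expectation (\<lambda>\<omega>. 1 / (real n * real b) * (\<Sum>i=1..n. (norm (refreshed_residual G c z (fst (sample k \<omega>)) i))\<^sup>2))"
proof -
  have norm_sq: "(norm v)\<^sup>2 = (\<Sum>c\<in>UNIV. (v $ c)\<^sup>2)" for v :: "real ^ 'p"
    unfolding power2_norm_eq_inner by (simp add: inner_vec_def power2_eq_square)
  have batch: "expectation (\<lambda>\<omega>. (norm (batch_error n b r (\<lambda>j. B k j \<omega>)))\<^sup>2)
      \<le> 1 / (real n * real b) * (\<Sum>i=1..n. (norm (r i))\<^sup>2)" for r :: "nat \<Rightarrow> real ^ 'p"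
  proof -
    have int: "integrable M (\<lambda>\<omega>. (batch_error n b f (\<lambda>j. B k j \<omega>))\<^sup>2)" for f :: "nat \<Rightarrow> real"
      using integrable_of_sample[OF k, of "\<lambda>_ s. (batch_error n b f s)\<^sup>2"] by simp
    have "expectation (\<lambda>\<omega>. (norm (batch_error n b r (\<lambda>j. B k j \<omega>)))\<^sup>2)
        = (\<Sum>c\<in>UNIV. expectation (\<lambda>\<omega>. (batch_error n b (\<lambda>i. r i $ c) (\<lambda>j. B k j \<omega>))\<^sup>2))"
      unfolding norm_sq batch_error_component by (rule Bochner_Integration.integral_sum) (rule int)
    also have "\<dots> \<le> (\<Sum>c\<in>UNIV. (\<Sum>i=1..n. (r i $ c)\<^sup>2) / (real n * real b))"
      by (intro sum_mono expectation_batch_error_sq k n b)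
    also have "\<dots> = 1 / (real n * real b) * (\<Sum>i=1..n. (norm (r i))\<^sup>2)"
      unfolding norm_sq by (subst sum.swap) (simp add: sum_divide_distrib)
    finally show ?thesis .
  qed
  show ?thesis
    unfolding sample_def fst_conv snd_conv
  proof (subst expectation_sample[OF k], rule integral_mono)
    fix \<omega>
    show "expectation (\<lambda>\<omega>'. (norm (batch_error n b (refreshed_residual G c z (Bh k \<omega>)) (\<lambda>j\<in>{..<b}. B k j \<omega>')))\<^sup>2)
       \<le> 1 / (real n * real b) * (\<Sum>i=1..n. (norm (refreshed_residual G c z (Bh k \<omega>) i))\<^sup>2)"
      unfolding batch_error_restrict by (rule batch)
  qed (fact integrable_of_sample[OF k, of "\<lambda>A _. expectation (\<lambda>\<omega>'. (norm (batch_error n b (refreshed_residual G c z A) (\<lambda>j\<in>{..<b}. B k j \<omega>')))\<^sup>2)"]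
        integrable_of_sample[OF k, of "\<lambda>A _. 1 / (real n * real b) * (\<Sum>i=1..n. (norm (refreshed_residual G c z A i))\<^sup>2)"])+
qed

lemma expectation_refreshed_residual_sq:
  fixes G :: "nat \<Rightarrow> real ^ 'p \<Rightarrow> real ^ 'p"
  assumes k: "1 \<le> k" and b: "1 \<le> b" "b \<le> n"
  defines "\<beta> \<equiv> real b / real n"
  shows "expectation (\<lambda>\<omega>. 1 / (real n * real b) * (\<Sum>i=1..n. (norm (refreshed_residual G c (y, y', t) (fst (sample k \<omega>)) i))\<^sup>2))
    = 1 / (real n * real b) * (\<Sum>i=1..n. \<beta> * (norm (G i y - G i y'))\<^sup>2
        + (1 - \<beta>) * (norm ((G i y - G i y') + (1 - c) *\<^sub>R (G i y' - t i)))\<^sup>2)"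
proof -
  have eq: "(norm (refreshed_residual G c (y, y', t) A i))\<^sup>2 = (if i \<in> A then (norm (G i y - G i y'))\<^sup>2
      else (norm ((G i y - G i y') + (1 - c) *\<^sub>R (G i y' - t i)))\<^sup>2)" for A i
  proof -
    have "refreshed_residual G c (y, y', t) A i = (if i \<in> A then G i y - G i y'
      else (G i y - G i y') + (1 - c) *\<^sub>R (G i y' - t i))"
      by (simp add: refreshed_residual_def refresh_def algebra_simps)
    then show ?thesis by simp
  qed
  have "expectation (\<lambda>\<omega>. \<Sum>i=1..n. (norm (refreshed_residual G c (y, y', t) (fst (sample k \<omega>)) i))\<^sup>2)
    = (\<Sum>i=1..n. expectation (\<lambda>\<omega>. (norm (refreshed_residual G c (y, y', t) (Bh k \<omega>) i))\<^sup>2))"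
    unfolding sample_def fst_conv
    by (rule Bochner_Integration.integral_sum)
       (rule integrable_of_sample[OF k, of "\<lambda>A _. (norm (refreshed_residual G c (y, y', t) A i))\<^sup>2" for i])
  also have "\<dots> = (\<Sum>i=1..n. \<beta> * (norm (G i y - G i y'))\<^sup>2
        + (1 - \<beta>) * (norm ((G i y - G i y') + (1 - c) *\<^sub>R (G i y' - t i)))\<^sup>2)"
    unfolding eq \<beta>_def by (intro sum.cong refl expectation_refresh[OF k b])
  finally show ?thesis by simp
qed

end

text \<open>
  The average over the table of the bound for a single entry. With \<open>C = 2 (1 - \<beta>) (1 + 2 / \<beta>)\<close> as in
  \<open>refresh_contraction\<close> and \<open>\<beta> = b / n\<close>, the constants are \<open>\<Theta>h = C / b\<close> and \<open>\<Theta> = (\<beta> + C) / b\<close>.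
\<close>

lemma refreshed_Delta_recursion:
  fixes G :: "nat \<Rightarrow> real ^ 'p \<Rightarrow> real ^ 'p"
  assumes n: "1 \<le> n" and b: "1 \<le> b" "b \<le> n"
    and \<gamma>: "\<And>k. 0 \<le> \<gamma> k" "\<And>k. \<gamma> k < 1"
  defines "\<beta> \<equiv> real b / real n"
    and "\<Theta> \<equiv> (2 * (real n - real b) * (2 * real n + real b) + (real b)\<^sup>2) / (real n * (real b)\<^sup>2)"
    and "\<Theta>h \<equiv> 2 * (real n - real b) * (2 * real n + real b) / (real n * (real b)\<^sup>2)"
  shows "1 / (1 - \<gamma> k)\<^sup>2 * (1 / (real n * real b) * (\<Sum>i=1..n. \<beta> * (norm (G i (x k \<omega>) - G i (x (k - 1) \<omega>)))\<^sup>2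
        + (1 - \<beta>) * (norm ((G i (x k \<omega>) - G i (x (k - 1) \<omega>))
            + (1 - \<gamma> k) *\<^sub>R (G i (x (k - 1) \<omega>) - saga_table G Bh x (k - 1) i \<omega>)))\<^sup>2))
    \<le> (1 - real b / (2 * real n)) * (1 / (1 - \<gamma> (k - 1))\<^sup>2) * saga_Delta n b G \<gamma> Bh x (k - 1) \<omega>
       + \<Theta> / (1 - \<gamma> k)\<^sup>2 * G_increment n G x k \<omega> + \<Theta>h / (1 - \<gamma> (k - 1))\<^sup>2 * G_increment n G x (k - 1) \<omega>"
proof -
  define C where "C = 2 * (1 - \<beta>) * (1 + 2 / \<beta>)"
  define a where "a i = G i (x (k - 1) \<omega>) - \<gamma> (k - 1) *\<^sub>R G i (x (k - 1 - 1) \<omega>)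
     - (1 - \<gamma> (k - 1)) *\<^sub>R saga_table G Bh x (k - 1) i \<omega>" for i
  define d where "d i = G i (x k \<omega>) - G i (x (k - 1) \<omega>)" for i
  define d' where "d' i = G i (x (k - 1) \<omega>) - G i (x (k - 1 - 1) \<omega>)" for i
  define v where "v i = G i (x (k - 1) \<omega>) - saga_table G Bh x (k - 1) i \<omega>" for i
  define p q r where "p = (1 - \<beta> / 2) / (1 - \<gamma> (k - 1))\<^sup>2" and "q = (\<beta> + C) / (1 - \<gamma> k)\<^sup>2"
    and "r = C / (1 - \<gamma> (k - 1))\<^sup>2"
  have nb: "real n > 0" "real b > 0" using n b by auto
  have \<beta>: "0 < \<beta>" "\<beta> \<le> 1" using n b by (auto simp: \<beta>_def)
  have C: "C / real b = \<Theta>h" "(\<beta> + C) / real b = \<Theta>"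
    using nb by (simp_all add: C_def \<beta>_def \<Theta>_def \<Theta>h_def field_simps power2_eq_square)
  have term_le: "1 / (1 - \<gamma> k)\<^sup>2 * (\<beta> * (norm (d i))\<^sup>2 + (1 - \<beta>) * (norm (d i + (1 - \<gamma> k) *\<^sub>R v i))\<^sup>2)
      \<le> p * (norm (a i))\<^sup>2 + q * (norm (d i))\<^sup>2 + r * (norm (d' i))\<^sup>2" for i
    unfolding p_def q_def r_def C_def
    by (rule refresh_contraction[OF \<beta> \<gamma>(2) \<gamma>]) (simp add: a_def v_def d'_def algebra_simps)
  have "1 / (1 - \<gamma> k)\<^sup>2 * (1 / (real n * real b) *
        (\<Sum>i=1..n. \<beta> * (norm (d i))\<^sup>2 + (1 - \<beta>) * (norm (d i + (1 - \<gamma> k) *\<^sub>R v i))\<^sup>2))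
      = 1 / (real n * real b) * (\<Sum>i=1..n. 1 / (1 - \<gamma> k)\<^sup>2 *
          (\<beta> * (norm (d i))\<^sup>2 + (1 - \<beta>) * (norm (d i + (1 - \<gamma> k) *\<^sub>R v i))\<^sup>2))"
    unfolding sum_distrib_left[symmetric] by simp
  also have "\<dots> \<le> 1 / (real n * real b) *
      (\<Sum>i=1..n. p * (norm (a i))\<^sup>2 + q * (norm (d i))\<^sup>2 + r * (norm (d' i))\<^sup>2)"
    using nb by (intro mult_left_mono sum_mono term_le) simp
  also have "\<dots> = p * (1 / (real n * real b) * (\<Sum>i=1..n. (norm (a i))\<^sup>2))
      + q / real b * (1 / real n * (\<Sum>i=1..n. (norm (d i))\<^sup>2))
      + r / real b * (1 / real n * (\<Sum>i=1..n. (norm (d' i))\<^sup>2))"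
    unfolding sum.distrib sum_distrib_left[symmetric] by (simp add: distrib_left add_divide_distrib mult.commute)
  also have "\<dots> = p * saga_Delta n b G \<gamma> Bh x (k - 1) \<omega>
      + \<Theta> / (1 - \<gamma> k)\<^sup>2 * G_increment n G x k \<omega> + \<Theta>h / (1 - \<gamma> (k - 1))\<^sup>2 * G_increment n G x (k - 1) \<omega>"
    unfolding C[symmetric]
    by (simp add: q_def r_def saga_Delta_def G_increment_def a_def d_def d'_def mult.commute mult.left_commute)
  finally show ?thesis
    by (simp add: p_def \<beta>_def d_def v_def mult.commute)
qed

section \<open>The variance-reduction property of the SAGA estimator\<close>

theorem lemma2:
  fixes M :: "'w measure"
    and n b :: nat
    and G :: "nat \<Rightarrow> real ^ 'p \<Rightarrow> real ^ 'p"
    and \<theta> \<gamma> \<eta> :: "nat \<Rightarrow> real"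
    and B :: "nat \<Rightarrow> nat \<Rightarrow> 'w \<Rightarrow> nat"
    and Bh :: "nat \<Rightarrow> 'w \<Rightarrow> nat set"
    and x0 :: "real ^ 'p"
    and x St S :: "nat \<Rightarrow> 'w \<Rightarrow> real ^ 'p"
    and \<Delta> U :: "nat \<Rightarrow> 'w \<Rightarrow> real"
    and F :: "nat \<Rightarrow> 'w measure"
    and \<Theta> \<Theta>h :: real
  assumes n: "1 \<le> n"
    and b: "1 \<le> b" "b \<le> n"
    and \<gamma>: "\<And>k. 0 \<le> \<gamma> k" "\<And>k. \<gamma> k < 1"
    and sampling: "saga_sampling M n b B Bh"
    and F: "F = history M b B Bh"
    and S: "S = S_target n G \<gamma> x"
    and St: "St = saga_estimator n b G \<gamma> B Bh x"
    and VFKM: "is_VFKM M \<theta> \<eta> x0 St x"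
    and \<Delta>: "\<Delta> = saga_Delta n b G \<gamma> Bh x"
    and U: "U = G_increment n G x"
    and \<Theta>: "\<Theta> = (2 * (real n - real b) * (2 * real n + real b) + (real b)\<^sup>2) / (real n * (real b)\<^sup>2)"
    and \<Theta>h: "\<Theta>h = 2 * (real n - real b) * (2 * real n + real b) / (real n * (real b)\<^sup>2)"
  shows "(\<forall>k\<ge>1.
            (AE \<omega> in M. vec_cond_exp M (F k) (\<lambda>\<omega>'. St k \<omega>' - S k \<omega>') \<omega> = 0) \<and>
            (AE \<omega> in M. real_cond_exp M (F k) (\<lambda>\<omega>'. (norm (St k \<omega>' - S k \<omega>'))\<^sup>2) \<omega>
                         \<le> real_cond_exp M (F k) (\<Delta> k) \<omega>) \<and>
            (AE \<omega> in M. 1 / (1 - \<gamma> k)\<^sup>2 * real_cond_exp M (F k) (\<Delta> k) \<omega>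
                         \<le> (1 - real b / (2 * real n)) * (1 / (1 - \<gamma> (k - 1))\<^sup>2) * \<Delta> (k - 1) \<omega>
                           + \<Theta> / (1 - \<gamma> k)\<^sup>2 * U k \<omega>
                           + \<Theta>h / (1 - \<gamma> (k - 1))\<^sup>2 * U (k - 1) \<omega>)) \<and>
         VR_unbiased_estimator M F \<gamma> U S St (real b / (2 * real n)) \<Theta> \<Theta>h \<Delta>"
proof -
  interpret saga_sampling M n b B Bh by (rule sampling)
  note vfkm = VFKM[unfolded St]
  define err where "err k z w = batch_error n b (refreshed_residual G (\<gamma> k) z (fst w)) (snd w)"
    for k and z :: "(real ^ 'p) \<times> (real ^ 'p) \<times> (nat \<Rightarrow> real ^ 'p)" and w :: "nat set \<times> (nat \<Rightarrow> nat)"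
  define del where "del k z w = 1 / (real n * real b) * (\<Sum>i=1..n. (norm (refreshed_residual G (\<gamma> k) z (fst w) i))\<^sup>2)"
    for k and z :: "(real ^ 'p) \<times> (real ^ 'p) \<times> (nat \<Rightarrow> real ^ 'p)" and w :: "nat set \<times> (nat \<Rightarrow> nat)"
  have err: "St k \<omega> - S k \<omega> = err k (saga_state G Bh x k \<omega>) (sample k \<omega>)" if "1 \<le> k" for k \<omega>
    using saga_estimator_error[OF that, of n b G \<gamma> B Bh x \<omega>] by (simp add: St S err_def sample_def)
  have del: "\<Delta> k = (\<lambda>\<omega>. del k (saga_state G Bh x k \<omega>) (sample k \<omega>))" if "1 \<le> k" for k
    using saga_Delta_state[OF that, of n b G \<gamma> Bh x] by (simp add: \<Delta> del_def sample_def fun_eq_iff)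
  have unbiased: "AE \<omega> in M. vec_cond_exp M (F k) (\<lambda>\<omega>'. St k \<omega>' - S k \<omega>') \<omega> = 0" if k: "1 \<le> k" for k
  proof -
    have "AE \<omega> in M. real_cond_exp M (F k) (\<lambda>\<omega>'. (St k \<omega>' - S k \<omega>') $ c) \<omega> = 0" for c
      using real_cond_exp_history[OF vfkm k, of "\<lambda>z w. err k z w $ c"]
      unfolding err[OF k] F err_def expectation_estimator_error[OF k n b(1)] .
    then have "AE \<omega> in M. \<forall>c\<in>UNIV. real_cond_exp M (F k) (\<lambda>\<omega>'. (St k \<omega>' - S k \<omega>') $ c) \<omega> = 0"
      by (intro AE_finite_allI) auto
    then show ?thesis
      by eventually_elim (simp add: vec_cond_exp_def vec_eq_iff)
  qed
  have variance: "AE \<omega> in M. real_cond_exp M (F k) (\<lambda>\<omega>'. (norm (St k \<omega>' - S k \<omega>'))\<^sup>2) \<omega>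
      \<le> real_cond_exp M (F k) (\<Delta> k) \<omega>" if k: "1 \<le> k" for k
    using real_cond_exp_history[OF vfkm k, of "\<lambda>z w. (norm (err k z w))\<^sup>2"]
      real_cond_exp_history[OF vfkm k, of "del k"]
    unfolding err[OF k] del[OF k] F
  proof eventually_elim
    case (elim \<omega>)
    then show ?case
      using expectation_estimator_error_sq[OF k n b(1), of G "\<gamma> k" "saga_state G Bh x k \<omega>"]
      unfolding err_def del_def by simp
  qed
  have recursion: "AE \<omega> in M. 1 / (1 - \<gamma> k)\<^sup>2 * real_cond_exp M (F k) (\<Delta> k) \<omega>
      \<le> (1 - real b / (2 * real n)) * (1 / (1 - \<gamma> (k - 1))\<^sup>2) * \<Delta> (k - 1) \<omega>
        + \<Theta> / (1 - \<gamma> k)\<^sup>2 * U k \<omega> + \<Theta>h / (1 - \<gamma> (k - 1))\<^sup>2 * U (k - 1) \<omega>" if k: "1 \<le> k" for k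
    using real_cond_exp_history[OF vfkm k, of "del k"]
    unfolding del[OF k] F
  proof eventually_elim
    case (elim \<omega>)
    show ?case
      unfolding elim unfolding del_def saga_state_def expectation_refreshed_residual_sq[OF k b]
        \<Delta> U \<Theta> \<Theta>h
      by (rule refreshed_Delta_recursion[OF n b \<gamma>])
  qed
  have measurable: "\<Delta> k \<in> borel_measurable M" for k
  proof (cases "1 \<le> k")
    case True
    show ?thesis
      unfolding del[OF True]
      by (rule borel_measurable_integrable[OF integrable_of_state_sample[OF vfkm True, of "del k"]])
  next
    case False
    \<comment> \<open>No sample enters the control process at iteration 0, which is constant.\<close>
    then have "k = 0" by simp
    moreover have "x 0 \<omega> = x0" if "\<omega> \<in> space M" for \<omega>
      using VFKM that unfolding is_VFKM_def by blast
    ultimately show ?thesis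
      unfolding \<Delta> by (subst measurable_cong[where g = "\<lambda>_. 1 / (real n * real b) *
        (\<Sum>i=1..n. (norm (G i x0 - \<gamma> 0 *\<^sub>R G i x0 - (1 - \<gamma> 0) *\<^sub>R G i x0))\<^sup>2)"])
        (auto simp: saga_Delta_def)
  qed
  have nonneg: "0 \<le> \<Delta> k \<omega>" for k \<omega>
    by (simp add: \<Delta> saga_Delta_def sum_nonneg)
  have constants: "0 < real b / (2 * real n)" "real b / (2 * real n) < 1" "0 < \<Theta>" "0 \<le> \<Theta>h"
  proof -
    show "0 < real b / (2 * real n)" "real b / (2 * real n) < 1" "0 \<le> \<Theta>h"
      using n b by (auto simp: \<Theta>h)
    have "0 \<le> 2 * (real n - real b) * (2 * real n + real b)" "0 < (real b)\<^sup>2"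
      using b by auto
    then show "0 < \<Theta>"
      unfolding \<Theta> using n b by (intro divide_pos_pos add_nonneg_pos) auto
  qed
  have integrable: "integrable M (\<lambda>\<omega>. St k \<omega> - S k \<omega>)"
      "integrable M (\<lambda>\<omega>. (norm (St k \<omega> - S k \<omega>))\<^sup>2)" "integrable M (\<Delta> k)" if k: "1 \<le> k" for k
    unfolding err[OF k] del[OF k]
    by (fact integrable_of_state_sample[OF vfkm k, of "err k"]
        integrable_of_state_sample[OF vfkm k, of "\<lambda>z w. (norm (err k z w))\<^sup>2"]
        integrable_of_state_sample[OF vfkm k, of "del k"])+
  have "VR_unbiased_estimator M F \<gamma> U S St (real b / (2 * real n)) \<Theta> \<Theta>h \<Delta>"
    unfolding VR_unbiased_estimator_def
    using constants measurable nonneg integrable unbiased variance recursion by simp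
  then show ?thesis
    using unbiased variance recursion by blast
qed

end
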